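(* If a cube $A\in\mathcal{C}^3_3(v,k,\lambda)$ exists and $k$ is not divisible by $v$, then $$\lambda(v-1)\ge k\big(\lfloor k/v\rfloor+\lceil k/v\rceil-1\big)-v\lfloor k/v\rfloor\lceil k/v\rceil .$$ Equality holds if and only if every row-sum of $A$ is either $\lfloor k/v\rfloor$ or $\lceil k/v\rceil$. In that case, in any layer and for either of the two directions of parallel rows in that layer, among the $v$ parallel rows the sum $\lfloor k/v\rfloor$ occurs $\lceil k/v\rceil v-k$ times and the sum $\lceil k/v\rceil$ occurs $k-\lfloor k/v\rfloor v$ times.
   Context: A $v\times v\times v$ array is a function on $\{1,\dots,v\}^3$. A layer is a 2-dimensional subarray obtained by fixing one of the three coordinates; a row is a 1-dimensional subarray obtained by fixing two of the three coordinates (any two), and its row-sum is the sum of its $v$ entries. Two layers are parallel if they fix the same coordinate, to different values; their scalar product is the sum over all positions of the product of corresponding entries. $\mathcal{C}^3_3(v,k,\lambda)$ is the set of $v\times v\times v$ arrays over $\{0,1\}$ such that every layer (in each of the three directions) contains exactly $k$ ones and every two parallel layers have scalar product $\lambda$. *)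

theory Defs
  imports Complex_Main "HOL-Library.FuncSet"
begin

datatype axis = Axis1 | Axis2 | Axis3

type_synonym pos = "nat \<times> nat \<times> nat"

fun coord :: "axis \<Rightarrow> pos \<Rightarrow> nat" where
  "coord Axis1 (x, y, z) = x"
| "coord Axis2 (x, y, z) = y"
| "coord Axis3 (x, y, z) = z"

fun set_coord :: "axis \<Rightarrow> nat \<Rightarrow> pos \<Rightarrow> pos" where
  "set_coord Axis1 i (x, y, z) = (i, y, z)"
| "set_coord Axis2 i (x, y, z) = (x, i, z)"
| "set_coord Axis3 i (x, y, z) = (x, y, i)"

definition positions :: "nat \<Rightarrow> pos set" where
  "positions v = {1..v} \<times> {1..v} \<times> {1..v}"

(* Layers and rows are represented by the sets of positions they occupy. *)

definition layer :: "nat \<Rightarrow> axis \<Rightarrow> nat \<Rightarrow> pos set" where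
  "layer v d i = {p \<in> positions v. coord d p = i}"

(* A row for d \<noteq> e only.  For fixed d, i, e the sets row v d i e j with j = 1, ..., v
   are the parallel rows, in one of the two directions, of layer v d i. *)
definition row :: "nat \<Rightarrow> axis \<Rightarrow> nat \<Rightarrow> axis \<Rightarrow> nat \<Rightarrow> pos set" where
  "row v d i e j = {p \<in> positions v. coord d p = i \<and> coord e p = j}"

definition row_sum :: "nat \<Rightarrow> (pos \<Rightarrow> nat) \<Rightarrow> axis \<Rightarrow> nat \<Rightarrow> axis \<Rightarrow> nat \<Rightarrow> nat" where
  "row_sum v A d i e j = (\<Sum>p\<in>row v d i e j. A p)"

(* Entries of the layers d = i and d = j correspond when they differ only in coordinate d. *)
definition layer_product :: "nat \<Rightarrow> (pos \<Rightarrow> nat) \<Rightarrow> axis \<Rightarrow> nat \<Rightarrow> nat \<Rightarrow> nat" where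
  "layer_product v A d i j = (\<Sum>p\<in>layer v d i. A p * A (set_coord d j p))"

(* The set C^3_3(v,k,lambda). *)
definition cubes :: "nat \<Rightarrow> nat \<Rightarrow> nat \<Rightarrow> (pos \<Rightarrow> nat) set" where
  "cubes v k l = {A \<in> positions v \<rightarrow>\<^sub>E {0, 1}.
     (\<forall>d. \<forall>i\<in>{1..v}. card {p \<in> layer v d i. A p = 1} = k) \<and>
     (\<forall>d. \<forall>i\<in>{1..v}. \<forall>j\<in>{1..v}. i \<noteq> j \<longrightarrow> layer_product v A d i j = l)}"

end

theory Submission
  imports Defs
begin

text \<open>
  Fix a direction and let \<open>r\<close> range over the \<open>v\<^sup>2\<close> row-sums in that direction. The rows partition each
  layer, so the \<open>r\<close> add up to \<open>v k\<close>; expanding \<open>r\<^sup>2\<close> as a double sum over pairs of parallel layers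
  gives \<open>v (k + \<lambda> (v - 1))\<close> as the sum of the squares. With \<open>f\<close> the floor of \<open>k / v\<close>, no integer lies
  strictly between \<open>f\<close> and \<open>f + 1\<close>, so the sum of \<open>(r - f) (r - f - 1)\<close>, which is \<open>v\<close> times the
  difference of the two sides, has nonnegative terms, and it vanishes exactly if every \<open>r\<close> is \<open>f\<close>
  or \<open>f + 1\<close>.
\<close>

section \<open>Coordinates adapted to a pair of axes, and sums over rows and layers\<close>

text \<open>The position with coordinates \<open>i\<close> along \<open>d\<close>, \<open>j\<close> along \<open>e\<close> and \<open>t\<close> along the remaining axis.\<close>

definition point :: "axis \<Rightarrow> axis \<Rightarrow> nat \<Rightarrow> nat \<Rightarrow> nat \<Rightarrow> pos" where
  "point d e i j t = set_coord d i (set_coord e j (t, t, t))"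

lemma point_in_positions:
  assumes "i \<in> {1..v}" "j \<in> {1..v}" "t \<in> {1..v}"
  shows "point d e i j t \<in> positions v"
  using assms by (cases d; cases e) (auto simp: point_def positions_def)

lemma obtain_third_axis:
  fixes d e :: axis
  assumes "d \<noteq> e"
  obtains g where "g \<noteq> d" "g \<noteq> e"
  using assms that[of Axis1] that[of Axis2] that[of Axis3] by (cases d; cases e) simp_all

lemma set_coord_point:
  assumes "d \<noteq> e" "g \<noteq> d" "g \<noteq> e"
  shows "set_coord g s (point d e i j t) = point d e i j s"
  using assms by (cases d; cases e; cases g) (auto simp: point_def)

lemma coord_point:
  assumes "d \<noteq> e" "g \<noteq> d" "g \<noteq> e"
  shows "coord d (point d e i j t) = i" "coord e (point d e i j t) = j"
    "coord g (point d e i j t) = t"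
  using assms by (cases d; cases e; cases g; simp add: point_def)+

lemma point_coord:
  assumes "d \<noteq> e" "g \<noteq> d" "g \<noteq> e"
  shows "point d e (coord d p) (coord e p) (coord g p) = p"
  using assms by (cases p; cases d; cases e; cases g) (simp_all add: point_def)

lemma coord_in_range: "p \<in> positions v \<Longrightarrow> coord d p \<in> {1..v}"
  by (cases p; cases d) (auto simp: positions_def)

lemma sum_row:
  assumes "d \<noteq> e" "i \<in> {1..v}" "j \<in> {1..v}"
  shows "sum F (row v d i e j) = (\<Sum>t\<in>{1..v}. F (point d e i j t))"
proof -
  obtain g where g: "g \<noteq> d" "g \<noteq> e" using assms(1) by (rule obtain_third_axis)
  show ?thesis
    by (rule sum.reindex_bij_witness[of _ "point d e i j" "coord g"])
      (use assms(2,3) coord_in_range[of _ v g] in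
        \<open>auto simp: row_def point_in_positions coord_point[OF assms(1) g] point_coord[OF assms(1) g]\<close>)
qed

lemma sum_layer_first:
  assumes "d \<noteq> e" "i \<in> {1..v}"
  shows "sum F (layer v d i) = (\<Sum>j\<in>{1..v}. \<Sum>t\<in>{1..v}. F (point d e i j t))"
proof -
  obtain g where g: "g \<noteq> d" "g \<noteq> e" using assms(1) by (rule obtain_third_axis)
  show ?thesis
    unfolding sum.cartesian_product
    by (rule sum.reindex_bij_witness[of _ "\<lambda>(j, t). point d e i j t" "\<lambda>p. (coord e p, coord g p)"])
      (use assms(2) coord_in_range[of _ v g] coord_in_range[of _ v e] in
        \<open>auto simp: layer_def point_in_positions coord_point[OF assms(1) g] point_coord[OF assms(1) g]\<close>)
qed

text \<open>The layer here is perpendicular to the rows that fix \<open>d\<close> and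
  \<open>e\<close>: each such row meets it in exactly one position, so the pairs
  \<open>(i, j)\<close> that index the rows also index the layer.\<close>

lemma sum_layer_third:
  assumes "d \<noteq> e" "g \<noteq> d" "g \<noteq> e" "t \<in> {1..v}"
  shows "sum F (layer v g t) = (\<Sum>i\<in>{1..v}. \<Sum>j\<in>{1..v}. F (point d e i j t))"
  unfolding sum.cartesian_product
  by (rule sum.reindex_bij_witness[of _ "\<lambda>(i, j). point d e i j t" "\<lambda>p. (coord d p, coord e p)"])
    (use assms(4) coord_in_range[of _ v d] coord_in_range[of _ v e] in
      \<open>auto simp: layer_def point_in_positions coord_point[OF assms(1-3)] point_coord[OF assms(1-3)]\<close>)

section \<open>First and second moments of the row-sums of a cube\<close>

lemma cubes_entry:
  assumes "A \<in> cubes v k l" "p \<in> positions v"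
  shows "A p = 0 \<or> A p = 1"
  using assms PiE_mem[of A "positions v" "\<lambda>_. {0, 1}" p] by (auto simp: cubes_def)

lemma cubes_sum_layer:
  assumes "A \<in> cubes v k l" "i \<in> {1..v}"
  shows "sum A (layer v d i) = k"
proof -
  have fin: "finite (layer v d i)" by (simp add: layer_def positions_def)
  have "sum A (layer v d i) = (\<Sum>p\<in>layer v d i. if A p = 1 then 1 else 0)"
    by (rule sum.cong) (use cubes_entry[OF assms(1)] in \<open>auto simp: layer_def\<close>)
  also have "\<dots> = card {p \<in> layer v d i. A p = 1}"
    using fin by (simp add: sum.If_cases Int_def)
  finally show ?thesis using assms by (simp add: cubes_def)
qed

lemma cubes_row_sum_total:
  assumes "A \<in> cubes v k l" "d \<noteq> e" "i \<in> {1..v}"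
  shows "(\<Sum>j\<in>{1..v}. row_sum v A d i e j) = k"
  using cubes_sum_layer[OF assms(1,3), of d] sum_layer_first[OF assms(2,3), of A]
  by (simp add: row_sum_def sum_row[OF assms(2,3)])

text \<open>On the diagonal the value is \<open>k\<close> because entries in {0, 1} equal their own
  squares. Including this case lets the expansion of the squared row-sums run over all pairs of
  layers.\<close>

lemma cubes_layer_product:
  assumes "A \<in> cubes v k l" "s \<in> {1..v}" "t \<in> {1..v}"
  shows "layer_product v A d t s = (if s = t then k else l)"
proof (cases "s = t")
  case True
  have "A p * A (set_coord d t p) = A p" if "p \<in> layer v d t" for p
  proof -
    have "set_coord d t p = p" using that by (cases p; cases d) (auto simp: layer_def)
    moreover have "A p = 0 \<or> A p = 1"
      using that cubes_entry[OF assms(1)] by (auto simp: layer_def)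
    ultimately show ?thesis by auto
  qed
  then have "layer_product v A d t t = sum A (layer v d t)"
    unfolding layer_product_def by (intro sum.cong[OF refl])
  then show ?thesis using True cubes_sum_layer[OF assms(1,3)] by simp
next
  case False
  then show ?thesis using assms by (simp add: cubes_def)
qed

lemma cubes_row_sum_squares:
  assumes A: "A \<in> cubes v k l" and de: "d \<noteq> e"
  shows "(\<Sum>i\<in>{1..v}. \<Sum>j\<in>{1..v}. (row_sum v A d i e j)\<^sup>2) = v * (k + l * (v - 1))"
proof -
  obtain g where g: "g \<noteq> d" "g \<noteq> e" using de by (rule obtain_third_axis)
  let ?B = "\<lambda>i j t. A (point d e i j t)"
  have "(\<Sum>i\<in>{1..v}. \<Sum>j\<in>{1..v}. (row_sum v A d i e j)\<^sup>2) =
      (\<Sum>i\<in>{1..v}. \<Sum>j\<in>{1..v}. \<Sum>t\<in>{1..v}. \<Sum>s\<in>{1..v}. ?B i j t * ?B i j s)"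
    by (simp add: row_sum_def sum_row[OF de] power2_eq_square sum_product)
  \<comment> \<open>The swaps here and in the next step bring \<open>t\<close> and \<open>s\<close>
    outermost. For fixed \<open>t\<close> and \<open>s\<close>, the sum over \<open>i\<close> and
    \<open>j\<close> is then the scalar product of the layers \<open>t\<close> and \<open>s\<close>
    along \<open>g\<close>, the axis along which the rows run.\<close>
  also have "\<dots> = (\<Sum>i\<in>{1..v}. \<Sum>t\<in>{1..v}. \<Sum>s\<in>{1..v}. \<Sum>j\<in>{1..v}. ?B i j t * ?B i j s)"
    by (rule sum.cong[OF refl], rule trans[OF sum.swap], rule sum.cong[OF refl], rule sum.swap)
  also have "\<dots> = (\<Sum>t\<in>{1..v}. \<Sum>s\<in>{1..v}. \<Sum>i\<in>{1..v}. \<Sum>j\<in>{1..v}. ?B i j t * ?B i j s)"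
    by (rule trans[OF sum.swap], rule sum.cong[OF refl], rule sum.swap)
  also have "\<dots> = (\<Sum>t\<in>{1..v}. \<Sum>s\<in>{1..v}. layer_product v A g t s)"
    by (simp add: layer_product_def sum_layer_third[OF de g] set_coord_point[OF de g])
  also have "\<dots> = (\<Sum>t\<in>{1..v}. \<Sum>s\<in>{1..v}. if s = t then k else l)"
    by (intro sum.cong[OF refl]) (simp add: cubes_layer_product[OF A])
  \<comment> \<open>One \<open>s\<close> equals \<open>t\<close>, and \<open>v - 1\<close> others
    remain. The truncated subtraction is harmless, since for \<open>v = 0\<close> the outer sum is
    empty.\<close>
  also have "\<dots> = (\<Sum>t\<in>{1..v}. k + l * (v - 1))"
  proof (rule sum.cong[OF refl])
    fix t assume "t \<in> {1..v}"
    moreover have "(\<Sum>s\<in>{1..v} - {t}. if s = t then k else l) = (\<Sum>s\<in>{1..v} - {t}. l)"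
      by (rule sum.cong) auto
    ultimately show "(\<Sum>s\<in>{1..v}. if s = t then k else l) = k + l * (v - 1)"
      by (simp add: sum.remove[of _ t])
  qed
  finally show ?thesis by simp
qed

section \<open>The inequality and its equality case\<close>

lemma consecutive_product_nonneg:
  fixes r f :: int
  shows "0 \<le> (r - f) * (r - (f + 1))"
  by (cases "r \<le> f") (auto intro: mult_nonneg_nonneg mult_nonpos_nonpos)

text \<open>A polynomial identity in an arbitrary integer \<open>f\<close>, obtained from the first
  two moments; \<open>f\<close> becomes the floor only in the theorem.\<close>

lemma cubes_deficiency:
  fixes f :: int
  assumes A: "A \<in> cubes v k l" and de: "d \<noteq> e" and v: "v \<ge> 1"
  shows "(\<Sum>i\<in>{1..v}. \<Sum>j\<in>{1..v}. (int (row_sum v A d i e j) - f) * (int (row_sum v A d i e j) - (f + 1)))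
    = int v * (int l * (int v - 1) - (int k * (f + (f + 1) - 1) - int v * f * (f + 1)))"
proof -
  let ?r = "\<lambda>i j. int (row_sum v A d i e j)"
  have 1: "(\<Sum>i\<in>{1..v}. \<Sum>j\<in>{1..v}. (?r i j)\<^sup>2) = int v * (int k + int l * (int v - 1))"
    using arg_cong[OF cubes_row_sum_squares[OF A de], of int] v by (simp add: of_nat_diff)
  have "(\<Sum>j\<in>{1..v}. ?r i j) = int k" if "i \<in> {1..v}" for i
    using arg_cong[OF cubes_row_sum_total[OF A de that], of int] by simp
  then have 2: "(\<Sum>i\<in>{1..v}. \<Sum>j\<in>{1..v}. ?r i j) = int v * int k" by simp
  have "(\<Sum>i\<in>{1..v}. \<Sum>j\<in>{1..v}. (?r i j - f) * (?r i j - (f + 1))) =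
      (\<Sum>i\<in>{1..v}. \<Sum>j\<in>{1..v}. (?r i j)\<^sup>2 - (2 * f + 1) * ?r i j + f * (f + 1))"
    by (intro sum.cong[OF refl]) (simp add: algebra_simps power2_eq_square)
  also have "\<dots> = int v * (int k + int l * (int v - 1)) - (2 * f + 1) * (int v * int k)
      + int v * (int v * (f * (f + 1)))"
    unfolding sum.distrib sum_subtractf sum_distrib_left[symmetric] 1 2 by (simp add: algebra_simps)
  finally show ?thesis by (simp add: algebra_simps)
qed

lemma cubes_bound:
  fixes f :: int
  assumes "A \<in> cubes v k l" and "v \<ge> 1"
  shows "int k * (f + (f + 1) - 1) - int v * f * (f + 1) \<le> int l * (int v - 1)"
proof -
  have "0 \<le> int v * (int l * (int v - 1) - (int k * (f + (f + 1) - 1) - int v * f * (f + 1)))"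
    \<comment> \<open>\<open>axis.distinct(1)\<close> supplies the pair \<open>Axis1\<close>,
      \<open>Axis2\<close>: a single row direction already yields the bound.\<close>
    unfolding cubes_deficiency[OF assms(1) axis.distinct(1) assms(2), symmetric]
    by (intro sum_nonneg consecutive_product_nonneg)
  then show ?thesis using assms(2) by (simp add: zero_le_mult_iff)
qed

text \<open>The equation does not mention \<open>d\<close> and \<open>e\<close>, so two-valued
  row-sums in one direction force them in all three.\<close>

lemma cubes_bound_eq_iff:
  fixes f :: int
  assumes "A \<in> cubes v k l" "d \<noteq> e" "v \<ge> 1"
  shows "int l * (int v - 1) = int k * (f + (f + 1) - 1) - int v * f * (f + 1) \<longleftrightarrow>
    (\<forall>i\<in>{1..v}. \<forall>j\<in>{1..v}. int (row_sum v A d i e j) = f \<or> int (row_sum v A d i e j) = f + 1)"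
    (is "?L = ?R \<longleftrightarrow> ?rows")
proof -
  have "?L = ?R \<longleftrightarrow> int v * (?L - ?R) = 0" using assms(3) by simp
  also have "\<dots> \<longleftrightarrow> ?rows"
    unfolding cubes_deficiency[OF assms, symmetric]
    by (simp add: sum_nonneg_eq_0_iff sum_nonneg consecutive_product_nonneg)
  finally show ?thesis .
qed

text \<open>On the values \<open>f\<close> and \<open>f + 1\<close> the indicator functions are
  affine in \<open>r\<close>, namely \<open>f + 1 - r\<close> and \<open>r - f\<close>, so both
  counts are determined by the sum of \<open>r\<close>.\<close>

lemma two_valued_card:
  fixes r :: "'a \<Rightarrow> int"
  assumes "finite J" and two: "\<And>j. j \<in> J \<Longrightarrow> r j = f \<or> r j = f + 1"
  shows "int (card {j \<in> J. r j = f}) = (f + 1) * int (card J) - sum r J"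
    and "int (card {j \<in> J. r j = f + 1}) = sum r J - f * int (card J)"
proof -
  have "int (card {j \<in> J. r j = f}) = (\<Sum>j\<in>J. if r j = f then 1 else 0)"
    using assms(1) by (simp add: sum.If_cases Int_def)
  also have "\<dots> = (\<Sum>j\<in>J. (f + 1) - r j)" by (rule sum.cong[OF refl]) (use two in fastforce)
  finally show "int (card {j \<in> J. r j = f}) = (f + 1) * int (card J) - sum r J"
    by (simp add: sum_subtractf mult.commute)
  have "int (card {j \<in> J. r j = f + 1}) = (\<Sum>j\<in>J. if r j = f + 1 then 1 else 0)"
    using assms(1) by (simp add: sum.If_cases Int_def)
  also have "\<dots> = (\<Sum>j\<in>J. r j - f)" by (rule sum.cong[OF refl]) (use two in fastforce)
  finally show "int (card {j \<in> J. r j = f + 1}) = sum r J - f * int (card J)"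
    by (simp add: sum_subtractf mult.commute)
qed

text \<open>This is where non-divisibility enters: it keeps the quotient from being an integer, so
  floor and ceiling are consecutive.\<close>

lemma ceiling_divide_eq_floor_plus_one:
  assumes "\<not> v dvd k" "v \<ge> 1"
  shows "\<lceil>real k / real v\<rceil> = \<lfloor>real k / real v\<rfloor> + 1"
proof -
  have "real k / real v \<notin> \<int>"
  proof
    assume "real k / real v \<in> \<int>"
    then obtain z where "real k / real v = of_int z" by (auto elim: Ints_cases)
    then have "real_of_int (int k) = real_of_int (z * int v)"
      using assms(2) by (simp add: field_simps)
    then have "int v dvd int k" by (simp only: of_int_eq_iff) simp
    then show False using assms(1) by simp
  qed
  then show ?thesis by (auto simp: ceiling_altdef Ints_def)
qed

theorem proposition2p2:
  fixes v k l :: nat and A :: "pos \<Rightarrow> nat"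
  assumes "v \<ge> 1"
    and "A \<in> cubes v k l"
    and "\<not> v dvd k"
  shows "(let f = \<lfloor>real k / real v\<rfloor>; c = \<lceil>real k / real v\<rceil>;
              lhs = int l * (int v - 1);
              rhs = int k * (f + c - 1) - int v * f * c
          in lhs \<ge> rhs \<and>
             (lhs = rhs \<longleftrightarrow>
                (\<forall>d e. d \<noteq> e \<longrightarrow> (\<forall>i\<in>{1..v}. \<forall>j\<in>{1..v}.
                   int (row_sum v A d i e j) = f \<or> int (row_sum v A d i e j) = c))) \<and>
             (lhs = rhs \<longrightarrow>
                (\<forall>d e. d \<noteq> e \<longrightarrow> (\<forall>i\<in>{1..v}.
                   int (card {j \<in> {1..v}. int (row_sum v A d i e j) = f}) = c * int v - int k \<and>
                   int (card {j \<in> {1..v}. int (row_sum v A d i e j) = c}) = int k - f * int v))))"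
proof -
  define f where "f = \<lfloor>real k / real v\<rfloor>"
  have c: "\<lceil>real k / real v\<rceil> = f + 1"
    unfolding f_def using assms(3,1) by (rule ceiling_divide_eq_floor_plus_one)
  let ?r = "\<lambda>d i e j. int (row_sum v A d i e j)"
  let ?eq = "int l * (int v - 1) = int k * (f + (f + 1) - 1) - int v * f * (f + 1)"
  have rows: "?eq \<longleftrightarrow> (\<forall>i\<in>{1..v}. \<forall>j\<in>{1..v}. ?r d i e j = f \<or> ?r d i e j = f + 1)"
    if "d \<noteq> e" for d e
    using assms(2) that assms(1) by (rule cubes_bound_eq_iff)
  have all_rows: "?eq \<longleftrightarrow> (\<forall>d e. d \<noteq> e \<longrightarrow>
      (\<forall>i\<in>{1..v}. \<forall>j\<in>{1..v}. ?r d i e j = f \<or> ?r d i e j = f + 1))"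
    \<comment> \<open>A pair of distinct axes has to be exhibited so that the universal statement is
      not vacuous when the equality is derived from it.\<close>
    using rows axis.distinct(1) by blast
  have counts: "int (card {j \<in> {1..v}. ?r d i e j = f}) = (f + 1) * int v - int k \<and>
      int (card {j \<in> {1..v}. ?r d i e j = f + 1}) = int k - f * int v"
    if "?eq" "d \<noteq> e" "i \<in> {1..v}" for d e i
  proof -
    have two: "\<And>j. j \<in> {1..v} \<Longrightarrow> ?r d i e j = f \<or> ?r d i e j = f + 1"
      using rows[OF that(2)] that(1,3) by blast
    have total: "(\<Sum>j\<in>{1..v}. ?r d i e j) = int k"
      using arg_cong[OF cubes_row_sum_total[OF assms(2) that(2,3)], of int] by simp
    show ?thesis
      using two_valued_card[of "{1..v}" "?r d i e" f, OF finite_atLeastAtMost two]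
      unfolding total by simp
  qed
  show ?thesis
    unfolding Let_def c f_def[symmetric]
    using cubes_bound[OF assms(2,1), of f] all_rows counts by blast
qed

end
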